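(* Let $Q\subset\mathbb{R}^{d+1}$ be an open set and let $Lu=-u_t-\operatorname{tr}(aD^2u)-\langle b,Du\rangle+cu$ have the weak maximum principle property on $Q\cup\Sigma$ for $\mathfrak K$, where $\mathfrak{K}\subset C^2(Q)$ (respectively, $\mathfrak{K}\subset W^{2,d+1}_{\mathrm{loc}}(Q)$) is a convex cone and $\Sigma\subseteq\partial_PQ$ is an open subset. Suppose that $u,-v\in\mathfrak K$. (a) If $Lu\le Lv$ (a.e.) on $Q$ and $u^*\le v_*$ on $\partial_PQ\setminus\overline\Sigma$, then $u\le v$ on $Q$. (b) If $Lu=Lv$ (a.e.) on $Q$ and $u^*=v_*$ on $\partial_PQ\setminus\overline\Sigma$, then $u=v$ on $Q$ and $u=v\in C(Q\cup(\partial_PQ\setminus\overline\Sigma))$.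
   Context: Points of $\mathbb{R}^{d+1}$ are $(t,x)$, $t\in\mathbb{R}$, $x\in\mathbb{R}^d$; $D,D^2$ are the gradient and Hessian in $x$ only. The coefficients are $a$ (values in non-negative definite symmetric $d\times d$ matrices), $b$ ($\mathbb{R}^d$-valued), $c$ (real-valued), defined on $Q$ (in the $C^2$ case), respectively measurable and defined a.e. on $Q$ (in the $W^{2,d+1}_{\mathrm{loc}}$ case); "(a.e.)" refers to the latter case. The parabolic boundary (terminal-value convention) is $\partial_PQ:=\{(t^0,x^0)\in\partial Q:\ \{(t,x):|x-x^0|<\varepsilon,\ t^0-\varepsilon^2<t<t^0\}\cap Q\neq\emptyset\ \ \forall\,\varepsilon>0\}$, with $\partial Q$ the topological boundary, and $\overline\Sigma$ is the closure of $\Sigma$ in $\partial Q$. $C^2(Q)$ is the set of $u$ with $u,u_t,Du,D^2u$ continuous on $Q$. $W^{2,p}_{\mathrm{loc}}(Q)$ is the set of measurable $u$ such that $u$ and its weak derivatives $u_t,u_{x_i},u_{x_ix_j}$ belong to $L^p_{\mathrm{loc}}(Q)$; elements of $W^{2,d+1}_{\mathrm{loc}}(Q)$ are identified with their continuous representatives. $u^*,u_*:\overline Q\to[-\infty,\infty]$ are the upper and lower semicontinuous envelopes (limsup and liminf from $Q$). A convex cone $\mathfrak K$ satisfies $\alpha u+\beta v\in\mathfrak K$ whenever $u,v\in\mathfrak K$ and $\alpha,\beta\ge0$. Weak maximum principle property on $Q\cup\Sigma$ for $\mathfrak K$: whenever $w\in\mathfrak K$ satisfies $Lw\le0$ (a.e.)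 on $Q$ and $w^*\le0$ on $\partial_PQ\setminus\overline\Sigma$, then $w\le0$ on $Q$.
   Formalization: Part (a) excludes boundary points where u^* = v_* is infinite; part (b) additionally assumes v, -u in K, v^* = u_*, and that u^* is finite on the boundary part considered; the statement as written has counterexamples without these. *)

theory Defs
  imports "HOL-Analysis.Analysis"
begin

text \<open>
  Points of \<open>\<real>\<^sup>d\<^sup>+\<^sup>1\<close> are pairs \<open>(t, x)\<close> of type \<open>real \<times> (real ^ 'd)\<close>, whose norm and Lebesgue measure
  are the Euclidean ones. Functions are total; their values outside \<open>Q\<close> play no role.
\<close>

datatype regime = Classical | Sobolev

fun holds_on :: "regime \<Rightarrow> (real \<times> (real ^ 'd)) set \<Rightarrow> (real \<times> (real ^ 'd) \<Rightarrow> bool) \<Rightarrow> bool" where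
  "holds_on Classical Q P \<longleftrightarrow> (\<forall>z\<in>Q. P z)"
| "holds_on Sobolev Q P \<longleftrightarrow> (AE z in lebesgue_on Q. P z)"

subsection \<open>Classical derivatives\<close>

definition classical_derivs ::
  "(real \<times> (real ^ 'd)) set \<Rightarrow> (real \<times> (real ^ 'd) \<Rightarrow> real) \<Rightarrow> (real \<times> (real ^ 'd) \<Rightarrow> real) \<Rightarrow>
    (real \<times> (real ^ 'd) \<Rightarrow> real ^ 'd) \<Rightarrow> (real \<times> (real ^ 'd) \<Rightarrow> real ^ 'd ^ 'd) \<Rightarrow> bool" where
  "classical_derivs Q u ut Du D2u \<longleftrightarrow>
    (\<forall>(t, x)\<in>Q.
      ((\<lambda>s. u (s, x)) has_real_derivative ut (t, x)) (at t) \<and>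
      (GDERIV (\<lambda>y. u (t, y)) x :> Du (t, x)) \<and>
      ((\<lambda>y. Du (t, y)) has_derivative (\<lambda>h. D2u (t, x) *v h)) (at x))"

definition C2_space :: "(real \<times> (real ^ 'd)) set \<Rightarrow> (real \<times> (real ^ 'd) \<Rightarrow> real) set" where
  "C2_space Q = {u. \<exists>ut Du D2u. classical_derivs Q u ut Du D2u \<and>
    continuous_on Q u \<and> continuous_on Q ut \<and> continuous_on Q Du \<and> continuous_on Q D2u}"

subsection \<open>Weak derivatives\<close>

fun C_k :: "nat \<Rightarrow> ('a::euclidean_space \<Rightarrow> real) \<Rightarrow> bool" where
  "C_k 0 f \<longleftrightarrow> continuous_on UNIV f"
| "C_k (Suc k) f \<longleftrightarrow>
    (\<exists>f'. (\<forall>z. (f has_derivative f' z) (at z)) \<and> (\<forall>e\<in>Basis. C_k k (\<lambda>z. f' z e)))"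

definition test_functions :: "'a::euclidean_space set \<Rightarrow> ('a \<Rightarrow> real) set" where
  "test_functions Q = {\<phi>. (\<forall>k. C_k k \<phi>) \<and>
    compact (closure {z. \<phi> z \<noteq> 0}) \<and> closure {z. \<phi> z \<noteq> 0} \<subseteq> Q}"

definition Lp_loc :: "real \<Rightarrow> 'a::euclidean_space set \<Rightarrow> ('a \<Rightarrow> real) set" where
  "Lp_loc p Q = {f. f \<in> borel_measurable (lebesgue_on Q) \<and>
    (\<forall>C. compact C \<and> C \<subseteq> Q \<longrightarrow> integrable (lebesgue_on C) (\<lambda>z. \<bar>f z\<bar> powr p))}"

definition weak_deriv ::
  "'a::euclidean_space set \<Rightarrow> 'a \<Rightarrow> ('a \<Rightarrow> real) \<Rightarrow> ('a \<Rightarrow> real) \<Rightarrow> bool" where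
  "weak_deriv Q e f g \<longleftrightarrow> f \<in> Lp_loc 1 Q \<and> g \<in> Lp_loc 1 Q \<and>
    (\<forall>\<phi>\<in>test_functions Q.
      (LINT z|lebesgue_on Q. f z * frechet_derivative \<phi> (at z) e) =
      - (LINT z|lebesgue_on Q. g z * \<phi> z))"

definition weak_derivs ::
  "(real \<times> (real ^ 'd)) set \<Rightarrow> (real \<times> (real ^ 'd) \<Rightarrow> real) \<Rightarrow> (real \<times> (real ^ 'd) \<Rightarrow> real) \<Rightarrow>
    (real \<times> (real ^ 'd) \<Rightarrow> real ^ 'd) \<Rightarrow> (real \<times> (real ^ 'd) \<Rightarrow> real ^ 'd ^ 'd) \<Rightarrow> bool" where
  "weak_derivs Q u ut Du D2u \<longleftrightarrow>
    weak_deriv Q (1, 0) u ut \<and>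
    (\<forall>i. weak_deriv Q (0, axis i 1) u (\<lambda>z. Du z $ i)) \<and>
    (\<forall>i j. weak_deriv Q (0, axis j 1) (\<lambda>z. Du z $ i) (\<lambda>z. D2u z $ i $ j))"

text \<open>Continuity is part of the definition: elements of \<open>W\<^sup>2\<^sup>,\<^sup>p\<^sub>l\<^sub>o\<^sub>c(Q)\<close> are taken to be their continuous
  representatives.\<close>

definition W2p_loc :: "real \<Rightarrow> (real \<times> (real ^ 'd)) set \<Rightarrow> (real \<times> (real ^ 'd) \<Rightarrow> real) set" where
  "W2p_loc p Q = {u. continuous_on Q u \<and> u \<in> Lp_loc p Q \<and>
    (\<exists>ut Du D2u. weak_derivs Q u ut Du D2u \<and> ut \<in> Lp_loc p Q \<and>
      (\<forall>i. (\<lambda>z. Du z $ i) \<in> Lp_loc p Q) \<and> (\<forall>i j. (\<lambda>z. D2u z $ i $ j) \<in> Lp_loc p Q))}"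

subsection \<open>The operator\<close>

fun fun_space :: "regime \<Rightarrow> (real \<times> (real ^ 'd)) set \<Rightarrow> (real \<times> (real ^ 'd) \<Rightarrow> real) set" where
  "fun_space Classical Q = C2_space Q"
| "fun_space Sobolev Q = W2p_loc (real (CARD('d) + 1)) Q"

fun derivs_on :: "regime \<Rightarrow>
  (real \<times> (real ^ 'd)) set \<Rightarrow> (real \<times> (real ^ 'd) \<Rightarrow> real) \<Rightarrow> (real \<times> (real ^ 'd) \<Rightarrow> real) \<Rightarrow>
    (real \<times> (real ^ 'd) \<Rightarrow> real ^ 'd) \<Rightarrow> (real \<times> (real ^ 'd) \<Rightarrow> real ^ 'd ^ 'd) \<Rightarrow> bool" where
  "derivs_on Classical = classical_derivs"
| "derivs_on Sobolev = weak_derivs"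

fun measurable_coeffs :: "regime \<Rightarrow> (real \<times> (real ^ 'd)) set \<Rightarrow> (real \<times> (real ^ 'd) \<Rightarrow> real ^ 'd ^ 'd) \<Rightarrow>
    (real \<times> (real ^ 'd) \<Rightarrow> real ^ 'd) \<Rightarrow> (real \<times> (real ^ 'd) \<Rightarrow> real) \<Rightarrow> bool" where
  "measurable_coeffs Classical Q a b c \<longleftrightarrow> True"
| "measurable_coeffs Sobolev Q a b c \<longleftrightarrow> a \<in> borel_measurable (lebesgue_on Q) \<and>
    b \<in> borel_measurable (lebesgue_on Q) \<and> c \<in> borel_measurable (lebesgue_on Q)"

definition coefficients :: "regime \<Rightarrow> (real \<times> (real ^ 'd)) set \<Rightarrow> (real \<times> (real ^ 'd) \<Rightarrow> real ^ 'd ^ 'd) \<Rightarrow>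
    (real \<times> (real ^ 'd) \<Rightarrow> real ^ 'd) \<Rightarrow> (real \<times> (real ^ 'd) \<Rightarrow> real) \<Rightarrow> bool" where
  "coefficients m Q a b c \<longleftrightarrow> measurable_coeffs m Q a b c \<and>
    holds_on m Q (\<lambda>z. transpose (a z) = a z \<and> (\<forall>\<xi>. 0 \<le> \<xi> \<bullet> (a z *v \<xi>)))"

text \<open>
  \<open>is_L m a b c Q u f\<close> says that \<open>f\<close> is \<open>Lu\<close> on \<open>Q\<close>, respectively a version of it: weak derivatives,
  and hence \<open>Lu\<close> in the Sobolev case, are determined only almost everywhere.
\<close>

definition is_L :: "regime \<Rightarrow> (real \<times> (real ^ 'd) \<Rightarrow> real ^ 'd ^ 'd) \<Rightarrow>
    (real \<times> (real ^ 'd) \<Rightarrow> real ^ 'd) \<Rightarrow> (real \<times> (real ^ 'd) \<Rightarrow> real) \<Rightarrow> (real \<times> (real ^ 'd)) set \<Rightarrow>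
    (real \<times> (real ^ 'd) \<Rightarrow> real) \<Rightarrow> (real \<times> (real ^ 'd) \<Rightarrow> real) \<Rightarrow> bool" where
  "is_L m a b c Q u f \<longleftrightarrow> (\<exists>ut Du D2u. derivs_on m Q u ut Du D2u \<and>
    holds_on m Q (\<lambda>z. f z = - ut z - trace (a z ** D2u z) - b z \<bullet> Du z + c z * u z))"

subsection \<open>Boundary and envelopes\<close>

definition parabolic_boundary :: "(real \<times> (real ^ 'd)) set \<Rightarrow> (real \<times> (real ^ 'd)) set" where
  "parabolic_boundary Q = {(t0, x0). (t0, x0) \<in> frontier Q \<and>
    (\<forall>\<epsilon>>0. {(t, x). norm (x - x0) < \<epsilon> \<and> t0 - \<epsilon>\<^sup>2 < t \<and> t < t0} \<inter> Q \<noteq> {})}"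

definition remaining_boundary ::
  "(real \<times> (real ^ 'd)) set \<Rightarrow> (real \<times> (real ^ 'd)) set \<Rightarrow> (real \<times> (real ^ 'd)) set" where
  "remaining_boundary Q S = parabolic_boundary Q - (closure S \<inter> frontier Q)"

text \<open>The filter below, unlike \<open>at z within Q\<close>, does not exclude \<open>z\<close> itself when \<open>z \<in> Q\<close>.\<close>

definition usc_env :: "'a::topological_space set \<Rightarrow> ('a \<Rightarrow> real) \<Rightarrow> 'a \<Rightarrow> ereal" where
  "usc_env Q u z = Limsup (inf (nhds z) (principal Q)) (\<lambda>y. ereal (u y))"

definition lsc_env :: "'a::topological_space set \<Rightarrow> ('a \<Rightarrow> real) \<Rightarrow> 'a \<Rightarrow> ereal" where
  "lsc_env Q u z = Liminf (inf (nhds z) (principal Q)) (\<lambda>y. ereal (u y))"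

subsection \<open>The weak maximum principle property\<close>

definition fun_convex_cone :: "('a \<Rightarrow> real) set \<Rightarrow> bool" where
  "fun_convex_cone K \<longleftrightarrow>
    (\<forall>u\<in>K. \<forall>v\<in>K. \<forall>\<alpha>\<ge>0. \<forall>\<beta>\<ge>0. (\<lambda>z. \<alpha> * u z + \<beta> * v z) \<in> K)"

definition weak_max_principle :: "regime \<Rightarrow> (real \<times> (real ^ 'd) \<Rightarrow> real ^ 'd ^ 'd) \<Rightarrow>
    (real \<times> (real ^ 'd) \<Rightarrow> real ^ 'd) \<Rightarrow> (real \<times> (real ^ 'd) \<Rightarrow> real) \<Rightarrow> (real \<times> (real ^ 'd)) set \<Rightarrow>
    (real \<times> (real ^ 'd)) set \<Rightarrow> (real \<times> (real ^ 'd) \<Rightarrow> real) set \<Rightarrow> bool" where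
  "weak_max_principle m a b c Q S K \<longleftrightarrow>
    (\<forall>w\<in>K. \<forall>Lw. is_L m a b c Q w Lw \<and> holds_on m Q (\<lambda>z. Lw z \<le> 0) \<and>
      (\<forall>z\<in>remaining_boundary Q S. usc_env Q w z \<le> 0) \<longrightarrow> (\<forall>z\<in>Q. w z \<le> 0))"

text \<open>
  Comparison and uniqueness are obtained by applying the property to differences, which restricts
  how their hypotheses can be read.

  \<^item> An inequality \<open>u\<^sup>* \<le> v\<^sub>*\<close> between extended reals must exclude \<open>u\<^sup>* = v\<^sub>* = \<infinity>\<close> and
    \<open>u\<^sup>* = v\<^sub>* = -\<infinity>\<close>, where \<open>u\<^sup>* - v\<^sub>*\<close> is undefined. With \<open>Q = {t < 0}\<close>, \<open>L = -\<partial>\<^sub>t\<close>, \<open>v = -1/t\<close>, \<open>u = v + 1\<close>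
    and the cone of all \<open>pv + q\<close>, the weak maximum principle property holds, \<open>Lu = Lv\<close> and
    \<open>u\<^sup>* = v\<^sub>* = \<infinity>\<close> on \<open>t = 0\<close>, but \<open>u > v\<close>.

  \<^item> For uniqueness the hypotheses must be symmetric in \<open>u\<close> and \<open>v\<close>. Membership of \<open>u\<close> and \<open>-v\<close> in the cone
    is not enough: take \<open>L = -\<partial>\<^sub>t\<close>, \<open>Q = \<real>\<^sup>d\<^sup>+\<^sup>1\<close>, \<open>u = 0\<close>, \<open>v = 1\<close> and the cone of
    nonpositive constants. Nor is \<open>u\<^sup>* = v\<^sub>*\<close> without \<open>v\<^sup>* = u\<^sub>*\<close>: take \<open>Q = {t < 0}\<close>,
    \<open>v = t\<^sup>2 / (t\<^sup>2 + |x|\<^sup>2)\<close>, \<open>u = 0\<close>, \<open>a = b = 0\<close>, \<open>c = v\<^sub>t / v\<close> and the cone of real multiples of \<open>v\<close>;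
    here \<open>Lv = 0\<close> and \<open>v\<^sub>* = 0\<close> on \<open>t = 0\<close>.
\<close>

end

theory Submission
  imports Defs
begin

text \<open>
  Comparison is the weak maximum principle applied to the difference \<open>w = u - v\<close>, which lies in the
  cone because \<open>u\<close> and \<open>-v\<close> do. Two things have to be known about \<open>w\<close>.

  First, \<open>Lw = Lu - Lv\<close> (lemma \<open>is_L_diff\<close>). For classical derivatives this is immediate. For weak
  derivatives the defining identities can be subtracted because a locally integrable function times
  a continuous, compactly supported one is integrable (\<open>Lp_loc_mult_integrable\<close>), and both a test
  function and its directional derivatives are of this kind.

  Second, \<open>w\<^sup>* \<le> u\<^sup>* - v\<^sub>* \<le> 0\<close> on the boundary portion concerned (\<open>usc_env_diff_le_0\<close>), where
  infinities that cancel have to be excluded.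

  On that portion of the boundary the hypotheses of uniqueness give the chain
  \<open>v\<^sub>* \<le> v\<^sup>* = u\<^sub>* \<le> u\<^sup>* = v\<^sub>*\<close>, so all four envelopes coincide and are finite. Hence comparison
  applies in both directions and yields \<open>u = v\<close>. Moreover \<open>u\<close> has a limit at each of these
  boundary points, and the limits taken from \<open>Q\<close> form a continuous extension
  (\<open>continuous_on_limits\<close>).
\<close>

section \<open>Linearity of the operator\<close>

lemma holds_on_mono2:
  assumes "holds_on m Q P" "holds_on m Q R" "\<And>z. P z \<Longrightarrow> R z \<Longrightarrow> T z"
  shows "holds_on m Q T"
proof (cases m)
  case Classical
  then show ?thesis using assms by auto
next
  case Sobolev
  then have "AE z in lebesgue_on Q. P z" "AE z in lebesgue_on Q. R z"
    using assms by auto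
  then have "AE z in lebesgue_on Q. T z"
    by eventually_elim (rule assms(3))
  then show ?thesis using Sobolev by simp
qed

lemma classical_derivs_diff:
  assumes "classical_derivs Q u ut Du D2u" "classical_derivs Q v vt Dv D2v"
  shows "classical_derivs Q (\<lambda>z. u z - v z) (\<lambda>z. ut z - vt z) (\<lambda>z. Du z - Dv z) (\<lambda>z. D2u z - D2v z)"
  using assms unfolding classical_derivs_def split_beta matrix_vector_mult_diff_rdistrib
  by (intro ballI conjI DERIV_diff GDERIV_diff has_derivative_diff) blast+

lemma Lp_loc_1_diff:
  assumes "f \<in> Lp_loc 1 Q" "g \<in> Lp_loc 1 Q"
  shows "(\<lambda>z. f z - g z) \<in> Lp_loc 1 Q"
proof -
  have "integrable (lebesgue_on C) (\<lambda>z. \<bar>f z - g z\<bar>)" if C: "compact C" "C \<subseteq> Q" for C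
  proof (rule Bochner_Integration.integrable_bound)
    have "integrable (lebesgue_on C) (\<lambda>z. \<bar>f z\<bar>)" "integrable (lebesgue_on C) (\<lambda>z. \<bar>g z\<bar>)"
      using assms C by (auto simp: Lp_loc_def)
    then show "integrable (lebesgue_on C) (\<lambda>z. \<bar>f z\<bar> + \<bar>g z\<bar>)"
      by simp
    have "f \<in> borel_measurable (lebesgue_on C)" "g \<in> borel_measurable (lebesgue_on C)"
      using assms C by (auto simp: Lp_loc_def intro: measurable_restrict_mono)
    then show "(\<lambda>z. \<bar>f z - g z\<bar>) \<in> borel_measurable (lebesgue_on C)"
      by measurable
  qed auto
  then show ?thesis
    using assms by (auto simp: Lp_loc_def)
qed

text \<open>
  This gives a meaning to both integrals in the definition of a weak derivative. Without it they
  could be \<open>0\<close> by default, and would not be additive in \<open>f\<close>.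
\<close>

lemma Lp_loc_mult_integrable:
  fixes f h :: "'a::euclidean_space \<Rightarrow> real"
  assumes Q: "open Q" and f: "f \<in> Lp_loc 1 Q" and h: "continuous_on UNIV h"
    and C: "compact C" "C \<subseteq> Q" and h0: "\<And>z. z \<notin> C \<Longrightarrow> h z = 0"
  shows "integrable (lebesgue_on Q) (\<lambda>z. f z * h z)"
proof -
  have "compact (h ` C)"
    using C(1) h by (metis compact_continuous_image continuous_on_subset subset_UNIV)
  then obtain B where B: "\<And>z. z \<in> C \<Longrightarrow> \<bar>h z\<bar> \<le> B"
    by (metis compact_imp_bounded bounded_iff imageI real_norm_def)
  have hm: "h \<in> borel_measurable (lebesgue_on C)"
    using h by (intro measurable_restrict_space1 measurable_completion)
      (simp add: borel_measurable_continuous_onI)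
  have fm: "f \<in> borel_measurable (lebesgue_on C)"
    using f C by (auto simp: Lp_loc_def intro: measurable_restrict_mono)
  have "integrable (lebesgue_on C) (\<lambda>z. f z * h z)"
  proof (rule Bochner_Integration.integrable_bound)
    have "integrable (lebesgue_on C) (\<lambda>z. \<bar>f z\<bar>)"
      using f C by (auto simp: Lp_loc_def)
    then show "integrable (lebesgue_on C) (\<lambda>z. B * \<bar>f z\<bar>)"
      by simp
    show "(\<lambda>z. f z * h z) \<in> borel_measurable (lebesgue_on C)"
      using fm hm by measurable
    show "AE z in lebesgue_on C. norm (f z * h z) \<le> norm (B * \<bar>f z\<bar>)"
    proof (rule AE_I2)
      fix z assume "z \<in> space (lebesgue_on C)"
      then have "\<bar>h z\<bar> \<le> B"
        using B by simp
      then have "\<bar>h z\<bar> * \<bar>f z\<bar> \<le> \<bar>B\<bar> * \<bar>f z\<bar>"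
        by (intro mult_right_mono) auto
      then show "norm (f z * h z) \<le> norm (B * \<bar>f z\<bar>)"
        by (simp add: abs_mult mult.commute)
    qed
  qed
  moreover have "(\<lambda>z. indicat_real C z *\<^sub>R (f z * h z)) = (\<lambda>z. indicat_real Q z *\<^sub>R (f z * h z))"
    using C(2) h0 by (fastforce simp: indicator_def)
  moreover have "C \<in> sets lebesgue" "Q \<in> sets lebesgue"
    using fmeasurableD[OF lmeasurable_compact[OF C(1)]] Q by auto
  ultimately show ?thesis
    by (simp only: integrable_restrict_space sets.Int_space_eq2)
qed

text \<open>
  Smoothness of a test function is phrased with the derivative along the standard basis only, so
  other directions are reached by linearity.
\<close>

lemma test_function_directional_derivative:
  fixes \<phi> :: "'a::euclidean_space \<Rightarrow> real"
  assumes "\<phi> \<in> test_functions Q"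
  shows "continuous_on UNIV (\<lambda>z. frechet_derivative \<phi> (at z) e)"
    and "z \<notin> closure {z. \<phi> z \<noteq> 0} \<Longrightarrow> frechet_derivative \<phi> (at z) e = 0"
proof -
  have "C_k (Suc 0) \<phi>"
    using assms unfolding test_functions_def by blast
  then obtain f' where f': "\<And>z. (\<phi> has_derivative f' z) (at z)"
    and cont: "\<And>i. i \<in> Basis \<Longrightarrow> continuous_on UNIV (\<lambda>z. f' z i)"
    by auto
  have eq: "frechet_derivative \<phi> (at z) = f' z" for z
    using frechet_derivative_at[OF f'] by simp
  have expand: "f' z e = (\<Sum>i\<in>Basis. (e \<bullet> i) *\<^sub>R f' z i)" for z
  proof -
    interpret linear "f' z"
      using f' by (rule has_derivative_linear)
    have "f' z e = f' z (\<Sum>i\<in>Basis. (e \<bullet> i) *\<^sub>R i)"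
      by (simp add: euclidean_representation)
    then show ?thesis
      by (simp only: sum scale)
  qed
  show "continuous_on UNIV (\<lambda>z. frechet_derivative \<phi> (at z) e)"
    unfolding eq expand by (intro continuous_on_sum continuous_on_scaleR continuous_on_const cont)
  show "frechet_derivative \<phi> (at z) e = 0" if z: "z \<notin> closure {z. \<phi> z \<noteq> 0}" for z
  proof -
    have "(\<phi> has_derivative (\<lambda>_. 0)) (at z)"
    proof (rule has_derivative_transform_within_open)
      show "((\<lambda>_. 0) has_derivative (\<lambda>_. 0)) (at z)"
        by simp
      show "open (- closure {z. \<phi> z \<noteq> 0})" "z \<in> - closure {z. \<phi> z \<noteq> 0}"
        using z by auto
      show "0 = \<phi> y" if "y \<in> - closure {z. \<phi> z \<noteq> 0}" for y
        using that closure_subset[of "{z. \<phi> z \<noteq> 0}"] by auto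
    qed
    then have "(\<lambda>_. 0) = frechet_derivative \<phi> (at z)"
      by (rule frechet_derivative_at)
    from fun_cong[OF this, of e] show ?thesis
      by simp
  qed
qed

lemma weak_deriv_diff:
  assumes Q: "open Q" and "weak_deriv Q e f f'" "weak_deriv Q e g g'"
  shows "weak_deriv Q e (\<lambda>z. f z - g z) (\<lambda>z. f' z - g' z)"
proof -
  have Lp: "f \<in> Lp_loc 1 Q" "f' \<in> Lp_loc 1 Q" "g \<in> Lp_loc 1 Q" "g' \<in> Lp_loc 1 Q"
    using assms by (auto simp: weak_deriv_def)
  have "(LINT z|lebesgue_on Q. (f z - g z) * frechet_derivative \<phi> (at z) e) =
      - (LINT z|lebesgue_on Q. (f' z - g' z) * \<phi> z)" if \<phi>: "\<phi> \<in> test_functions Q" for \<phi>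
  proof -
    let ?C = "closure {z. \<phi> z \<noteq> 0}"
    have C: "compact ?C" "?C \<subseteq> Q"
      using \<phi> by (auto simp: test_functions_def)
    have "C_k 0 \<phi>"
      using \<phi> unfolding test_functions_def by blast
    then have cont: "continuous_on UNIV \<phi>"
      by simp
    have supp: "\<phi> z = 0" if "z \<notin> ?C" for z
      using that closure_subset[of "{z. \<phi> z \<noteq> 0}"] by auto
    have int: "integrable (lebesgue_on Q) (\<lambda>z. k z * \<phi> z)" if k: "k \<in> Lp_loc 1 Q" for k
      using Q k cont C supp by (rule Lp_loc_mult_integrable)
    have int': "integrable (lebesgue_on Q) (\<lambda>z. k z * frechet_derivative \<phi> (at z) e)"
      if k: "k \<in> Lp_loc 1 Q" for k
      using Q k test_function_directional_derivative(1)[OF \<phi>] C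
        test_function_directional_derivative(2)[OF \<phi>]
      by (rule Lp_loc_mult_integrable)
    show ?thesis
      using assms(2,3) \<phi> Lp by (simp add: weak_deriv_def left_diff_distrib int int')
  qed
  then show ?thesis
    using Lp by (auto simp: weak_deriv_def intro: Lp_loc_1_diff)
qed

lemma weak_derivs_diff:
  assumes "open Q" "weak_derivs Q u ut Du D2u" "weak_derivs Q v vt Dv D2v"
  shows "weak_derivs Q (\<lambda>z. u z - v z) (\<lambda>z. ut z - vt z) (\<lambda>z. Du z - Dv z) (\<lambda>z. D2u z - D2v z)"
  using assms unfolding weak_derivs_def vector_minus_component
  by (intro conjI allI weak_deriv_diff) auto

lemma derivs_on_diff:
  assumes "open Q" "derivs_on m Q u ut Du D2u" "derivs_on m Q v vt Dv D2v"
  shows "derivs_on m Q (\<lambda>z. u z - v z) (\<lambda>z. ut z - vt z) (\<lambda>z. Du z - Dv z) (\<lambda>z. D2u z - D2v z)"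
  using assms by (cases m) (auto intro: classical_derivs_diff weak_derivs_diff)

lemma trace_matrix_mult_diff:
  fixes A B C :: "real ^ 'n ^ 'n"
  shows "trace (A ** (B - C)) = trace (A ** B) - trace (A ** C)"
  by (simp add: trace_def matrix_matrix_mult_def sum_subtractf right_diff_distrib)

lemma is_L_diff:
  assumes Q: "open Q" and u: "is_L m a b c Q u f" and v: "is_L m a b c Q v g"
  shows "is_L m a b c Q (\<lambda>z. u z - v z) (\<lambda>z. f z - g z)"
proof -
  obtain ut Du D2u where u: "derivs_on m Q u ut Du D2u"
    "holds_on m Q (\<lambda>z. f z = - ut z - trace (a z ** D2u z) - b z \<bullet> Du z + c z * u z)"
    using u unfolding is_L_def by blast
  obtain vt Dv D2v where v: "derivs_on m Q v vt Dv D2v"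
    "holds_on m Q (\<lambda>z. g z = - vt z - trace (a z ** D2v z) - b z \<bullet> Dv z + c z * v z)"
    using v unfolding is_L_def by blast
  have "holds_on m Q (\<lambda>z. f z - g z = - (ut z - vt z) - trace (a z ** (D2u z - D2v z))
      - b z \<bullet> (Du z - Dv z) + c z * (u z - v z))"
    by (rule holds_on_mono2[OF u(2) v(2)])
      (simp add: trace_matrix_mult_diff inner_diff_right right_diff_distrib)
  then show ?thesis
    unfolding is_L_def using derivs_on_diff[OF Q u(1) v(1)] by blast
qed

section \<open>Envelopes of a difference and comparison\<close>

text \<open>
  If \<open>u\<^sup>* < v\<^sub>*\<close>, then \<open>u\<close> and \<open>v\<close> are eventually separated by a number lying strictly between; if
  \<open>u\<^sup>* = v\<^sub>*\<close> is a real number, then \<open>u - v\<close> eventually drops below any prescribed \<open>\<epsilon> > 0\<close>.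
\<close>

lemma usc_env_diff_le_0:
  assumes le: "usc_env Q u z \<le> lsc_env Q v z"
    and fin: "\<not> (usc_env Q u z = lsc_env Q v z \<and> \<bar>usc_env Q u z\<bar> = \<infinity>)"
  shows "usc_env Q (\<lambda>z. u z - v z) z \<le> 0"
proof -
  let ?F = "inf (nhds z) (principal Q)"
  have below: "\<forall>\<^sub>F y in ?F. ereal (u y) < s" if "usc_env Q u z < s" for s
    using Limsup_lessD that unfolding usc_env_def by fast
  have above: "\<forall>\<^sub>F y in ?F. s < ereal (v y)" if "s < lsc_env Q v z" for s
    using less_LiminfD that unfolding lsc_env_def by fast
  have "\<forall>\<^sub>F y in ?F. ereal (u y - v y) < \<epsilon>" if \<epsilon>: "0 < \<epsilon>" for \<epsilon>
  proof (cases "usc_env Q u z < lsc_env Q v z")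
    case True
    then obtain r where r: "usc_env Q u z < r" "r < lsc_env Q v z"
      using dense by blast
    have "\<forall>\<^sub>F y in ?F. ereal (u y) < r \<and> r < ereal (v y)"
      using below[OF r(1)] above[OF r(2)] by (rule eventually_conj)
    then show ?thesis
    proof eventually_elim
      case (elim y)
      then have "ereal (u y) < ereal (v y)"
        by (blast intro: less_trans)
      then have "ereal (u y - v y) < 0"
        by simp
      then show ?case
        using \<epsilon> by (rule less_trans)
    qed
  next
    case False
    then obtain r where r: "usc_env Q u z = ereal r" "lsc_env Q v z = ereal r"
      using le fin by (cases "usc_env Q u z") auto
    obtain e where e: "0 < e" "ereal e < \<epsilon>"
      using \<epsilon> ereal_dense2 zero_ereal_def by force
    have "\<forall>\<^sub>F y in ?F. ereal (u y) < ereal (r + e / 2) \<and> ereal (r - e / 2) < ereal (v y)"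
      using e(1) r by (intro eventually_conj below above) auto
    then show ?thesis
    proof eventually_elim
      case (elim y)
      then have "ereal (u y - v y) < ereal e"
        by simp
      then show ?case
        using e(2) by (rule less_trans)
    qed
  qed
  then show ?thesis
    unfolding usc_env_def Limsup_le_iff by blast
qed

lemma comparison:
  assumes Q: "open Q" and cone: "fun_convex_cone K" and wmp: "weak_max_principle m a b c Q S K"
    and K: "u \<in> K" "(\<lambda>z. - v z) \<in> K" and L: "is_L m a b c Q u Lu" "is_L m a b c Q v Lv"
    and le: "holds_on m Q (\<lambda>z. Lu z \<le> Lv z)"
    and bdry: "\<And>z. z \<in> remaining_boundary Q S \<Longrightarrow> usc_env Q u z \<le> lsc_env Q v z \<and>
      \<not> (usc_env Q u z = lsc_env Q v z \<and> \<bar>usc_env Q u z\<bar> = \<infinity>)"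
    and z: "z \<in> Q"
  shows "u z \<le> v z"
proof -
  let ?w = "\<lambda>z. u z - v z"
  have "(\<lambda>z. 1 * u z + 1 * (- v z)) \<in> K"
    using cone K unfolding fun_convex_cone_def by (metis zero_le_one)
  then have "?w \<in> K"
    by simp
  moreover have "holds_on m Q (\<lambda>z. Lu z - Lv z \<le> 0)"
    using le le by (rule holds_on_mono2) simp
  moreover have "\<forall>z\<in>remaining_boundary Q S. usc_env Q ?w z \<le> 0"
    using bdry usc_env_diff_le_0 by blast
  ultimately have "\<forall>z\<in>Q. ?w z \<le> 0"
    using wmp is_L_diff[OF Q L] unfolding weak_max_principle_def by blast
  then show ?thesis
    using z by simp
qed

section \<open>Continuous extension to the boundary\<close>

lemma nhds_inf_principal_neq_bot:
  assumes "z \<in> closure Q"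
  shows "inf (nhds z) (principal Q) \<noteq> bot"
proof
  assume "inf (nhds z) (principal Q) = bot"
  then have "\<forall>\<^sub>F y in nhds z. y \<notin> Q"
    by (simp add: trivial_limit_def eventually_inf_principal)
  then obtain U where "open U" "z \<in> U" "U \<inter> Q = {}"
    unfolding eventually_nhds by blast
  then show False
    using assms by (metis IntI empty_iff open_Int_closure_eq_empty)
qed

lemma lsc_env_le_usc_env:
  assumes "z \<in> closure Q"
  shows "lsc_env Q u z \<le> usc_env Q u z"
  unfolding lsc_env_def usc_env_def
  using nhds_inf_principal_neq_bot[OF assms] by (rule Liminf_le_Limsup)

lemma tendsto_if_envelopes_eq:
  assumes "z \<in> closure Q" "lsc_env Q u z = usc_env Q u z" "\<bar>usc_env Q u z\<bar> \<noteq> \<infinity>"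
  shows "(u \<longlongrightarrow> real_of_ereal (usc_env Q u z)) (inf (nhds z) (principal Q))"
proof -
  have "((\<lambda>y. ereal (u y)) \<longlongrightarrow> usc_env Q u z) (inf (nhds z) (principal Q))"
    using assms(2) Liminf_eq_Limsup[OF nhds_inf_principal_neq_bot[OF assms(1)]]
    unfolding lsc_env_def usc_env_def by blast
  then show ?thesis
    using assms(3) by (metis ereal_real' lim_ereal)
qed

text \<open>
  If \<open>u\<close> stays in a closed ball around \<open>g z\<close> on a neighbourhood of \<open>z\<close>, then so do the limits of \<open>u\<close>
  at the points of that neighbourhood, which are the values of \<open>g\<close> there.
\<close>

lemma continuous_on_limits:
  fixes g :: "'a::topological_space \<Rightarrow> 'b::metric_space"
  assumes X: "X \<subseteq> closure Q"
    and lim: "\<And>z. z \<in> X \<Longrightarrow> (u \<longlongrightarrow> g z) (inf (nhds z) (principal Q))"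
  shows "continuous_on X g"
  unfolding continuous_on_def
proof (intro ballI tendstoI)
  fix z and e :: real
  assume z: "z \<in> X" and e: "0 < e"
  have "\<forall>\<^sub>F y in inf (nhds z) (principal Q). dist (u y) (g z) < e / 2"
    using lim[OF z] e by (intro tendstoD) auto
  then obtain U where U: "open U" "z \<in> U" "\<And>y. y \<in> U \<Longrightarrow> y \<in> Q \<Longrightarrow> dist (u y) (g z) < e / 2"
    unfolding eventually_inf_principal eventually_nhds by blast
  have close: "dist (g x) (g z) < e" if x: "x \<in> U" "x \<in> X" for x
  proof -
    have "\<forall>\<^sub>F y in inf (nhds x) (principal Q). dist (u y) (g z) \<le> e / 2"
      unfolding eventually_inf_principal eventually_nhds using U x by fastforce
    moreover have "((\<lambda>y. dist (u y) (g z)) \<longlongrightarrow> dist (g x) (g z)) (inf (nhds x) (principal Q))"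
      using lim[OF x(2)] by (intro tendsto_intros)
    moreover have "inf (nhds x) (principal Q) \<noteq> bot"
      using X x(2) by (intro nhds_inf_principal_neq_bot) auto
    ultimately have "dist (g x) (g z) \<le> e / 2"
      by (metis tendsto_upperbound)
    then show ?thesis
      using e by simp
  qed
  then show "\<forall>\<^sub>F x in at z within X. dist (g x) (g z) < e"
    unfolding eventually_at_topological using U by blast
qed

lemma fun_space_continuous_on:
  assumes "u \<in> fun_space m Q"
  shows "continuous_on Q u"
  using assms by (cases m) (auto simp: C2_space_def W2p_loc_def)

lemma remaining_boundary_subset_frontier: "remaining_boundary Q S \<subseteq> frontier Q"
  unfolding remaining_boundary_def parabolic_boundary_def by auto

section \<open>Comparison and uniqueness\<close>

theorem proposition2p5:
  fixes m :: regime
    and Q S :: "(real \<times> (real ^ 'd)) set"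
    and a :: "real \<times> (real ^ 'd) \<Rightarrow> real ^ 'd ^ 'd"
    and b :: "real \<times> (real ^ 'd) \<Rightarrow> real ^ 'd"
    and c :: "real \<times> (real ^ 'd) \<Rightarrow> real"
    and K :: "(real \<times> (real ^ 'd) \<Rightarrow> real) set"
    and u v Lu Lv :: "real \<times> (real ^ 'd) \<Rightarrow> real"
  assumes "open Q"
    and "coefficients m Q a b c"
    and "K \<subseteq> fun_space m Q" and "fun_convex_cone K"
    and "openin (top_of_set (parabolic_boundary Q)) S"
    and "weak_max_principle m a b c Q S K"
    and "u \<in> K" and "(\<lambda>z. - v z) \<in> K"
    and "is_L m a b c Q u Lu" and "is_L m a b c Q v Lv"
  shows
    "(holds_on m Q (\<lambda>z. Lu z \<le> Lv z) \<and>
      (\<forall>z\<in>remaining_boundary Q S. usc_env Q u z \<le> lsc_env Q v z \<and>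
        \<not> (usc_env Q u z = lsc_env Q v z \<and> \<bar>usc_env Q u z\<bar> = \<infinity>))
      \<longrightarrow> (\<forall>z\<in>Q. u z \<le> v z)) \<and>
     (v \<in> K \<and> (\<lambda>z. - u z) \<in> K \<and>
      holds_on m Q (\<lambda>z. Lu z = Lv z) \<and>
      (\<forall>z\<in>remaining_boundary Q S. usc_env Q u z = lsc_env Q v z \<and>
        usc_env Q v z = lsc_env Q u z \<and> \<bar>usc_env Q u z\<bar> \<noteq> \<infinity>)
      \<longrightarrow> (\<forall>z\<in>Q. u z = v z) \<and>
          (\<exists>g. continuous_on (Q \<union> remaining_boundary Q S) g \<and>
            (\<forall>z\<in>Q. g z = u z \<and> g z = v z)))"
proof -
  note Q = assms(1) and cone = assms(4) and wmp = assms(6)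
  let ?R = "remaining_boundary Q S"
  have cl: "?R \<subseteq> closure Q"
    using remaining_boundary_subset_frontier[of Q S] by (auto simp: frontier_def)
  have disj: "z \<notin> Q" if "z \<in> ?R" for z
    using remaining_boundary_subset_frontier[of Q S] that Q
    by (auto simp: frontier_def interior_open)
  have part_a: "\<forall>z\<in>Q. u z \<le> v z"
    if hyp: "holds_on m Q (\<lambda>z. Lu z \<le> Lv z) \<and>
      (\<forall>z\<in>?R. usc_env Q u z \<le> lsc_env Q v z \<and>
        \<not> (usc_env Q u z = lsc_env Q v z \<and> \<bar>usc_env Q u z\<bar> = \<infinity>))"
    using comparison[OF Q cone wmp assms(7-10) conjunct1[OF hyp] bspec[OF conjunct2[OF hyp]]]
    by (rule ballI)
  have part_b: "(\<forall>z\<in>Q. u z = v z) \<and>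
      (\<exists>g. continuous_on (Q \<union> ?R) g \<and> (\<forall>z\<in>Q. g z = u z \<and> g z = v z))"
    if hyp: "v \<in> K \<and> (\<lambda>z. - u z) \<in> K \<and> holds_on m Q (\<lambda>z. Lu z = Lv z) \<and>
      (\<forall>z\<in>?R. usc_env Q u z = lsc_env Q v z \<and>
        usc_env Q v z = lsc_env Q u z \<and> \<bar>usc_env Q u z\<bar> \<noteq> \<infinity>)"
  proof -
    have K: "v \<in> K" "(\<lambda>z. - u z) \<in> K" and L: "holds_on m Q (\<lambda>z. Lu z = Lv z)"
      and bdry: "\<forall>z\<in>?R. usc_env Q u z = lsc_env Q v z \<and>
        usc_env Q v z = lsc_env Q u z \<and> \<bar>usc_env Q u z\<bar> \<noteq> \<infinity>"
      by (insert hyp, elim conjE, assumption)+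
    have uv: "usc_env Q u z = lsc_env Q v z" and vu: "usc_env Q v z = lsc_env Q u z"
      and fin: "\<bar>usc_env Q u z\<bar> \<noteq> \<infinity>" if z: "z \<in> ?R" for z
      by (insert bspec[OF bdry z], elim conjE, assumption)+
    \<comment> \<open>The chain \<open>u\<^sup>* = v\<^sub>* \<le> v\<^sup>* = u\<^sub>* \<le> u\<^sup>*\<close>.\<close>
    have env: "lsc_env Q u z = usc_env Q u z" if z: "z \<in> ?R" for z
    proof (rule order_antisym)
      have "lsc_env Q u z \<le> usc_env Q u z" "lsc_env Q v z \<le> usc_env Q v z"
        using cl z by (auto intro: lsc_env_le_usc_env)
      then show "lsc_env Q u z \<le> usc_env Q u z" "usc_env Q u z \<le> lsc_env Q u z"
        unfolding uv[OF z] vu[OF z] by simp_all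
    qed
    have Lle: "holds_on m Q (\<lambda>z. Lu z \<le> Lv z)" "holds_on m Q (\<lambda>z. Lv z \<le> Lu z)"
      using holds_on_mono2[OF L L] by auto
    have "u z \<le> v z" if "z \<in> Q" for z
    proof (rule comparison[OF Q cone wmp assms(7-10) Lle(1) _ that])
      fix y assume y: "y \<in> ?R"
      show "usc_env Q u y \<le> lsc_env Q v y \<and>
          \<not> (usc_env Q u y = lsc_env Q v y \<and> \<bar>usc_env Q u y\<bar> = \<infinity>)"
        using uv[OF y] fin[OF y] by (metis order_refl)
    qed
    moreover have "v z \<le> u z" if "z \<in> Q" for z
    proof (rule comparison[OF Q cone wmp K assms(10,9) Lle(2) _ that])
      fix y assume y: "y \<in> ?R"
      show "usc_env Q v y \<le> lsc_env Q u y \<and>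
          \<not> (usc_env Q v y = lsc_env Q u y \<and> \<bar>usc_env Q v y\<bar> = \<infinity>)"
        using vu[OF y] env[OF y] fin[OF y] by (metis order_refl)
    qed
    ultimately have eq: "\<forall>z\<in>Q. u z = v z"
      using order_antisym by blast
    define g where "g z = (if z \<in> Q then u z else real_of_ereal (usc_env Q u z))" for z
    have "continuous_on (Q \<union> ?R) g"
    proof (rule continuous_on_limits)
      show "Q \<union> ?R \<subseteq> closure Q"
        using cl closure_subset by auto
      fix z assume "z \<in> Q \<union> ?R"
      then consider "z \<in> Q" | "z \<in> ?R"
        by blast
      then show "(u \<longlongrightarrow> g z) (inf (nhds z) (principal Q))"
      proof cases
        case 1
        have "continuous_on Q u"
          using assms(3,7) fun_space_continuous_on by blast
        then have "(u \<longlongrightarrow> u z) (nhds z)"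
          using Q 1 by (simp add: continuous_on_eq_continuous_at isCont_def tendsto_at_iff_tendsto_nhds)
        then have "(u \<longlongrightarrow> u z) (inf (nhds z) (principal Q))"
          using inf_le1 by (rule tendsto_mono[rotated])
        then show ?thesis
          using 1 by (simp add: g_def)
      next
        case 2
        then have "z \<in> closure Q" "g z = real_of_ereal (usc_env Q u z)"
          using cl disj by (auto simp: g_def)
        then show ?thesis
          using tendsto_if_envelopes_eq[OF _ env[OF 2] fin[OF 2]] by simp
      qed
    qed
    then show ?thesis
      using eq by (auto simp: g_def)
  qed
  show ?thesis
    by (rule conjI[OF impI[OF part_a] impI[OF part_b]])
qed

end
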